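(* Let $(X,\tau)$ and $(Y,\sigma)$ be topological spaces and let $f \colon (X,\tau) \rightarrow (Y,\sigma)$ be a surjection. If at least one of the following conditions holds, then $Y$ is strongly $S$-closed: (1) $f$ is contra-semicontinuous and $X$ is semi-compact; (2) $f$ is $SR$-continuous and $X$ is $s$-closed; (3) $f$ is completely continuous and $X$ is $S$-closed; (4) $f$ is contra-continuous and $X$ is compact; (5) $f$ is $RC$-continuous and $X$ is nearly compact; (6) $f$ is perfectly continuous and $X$ is mildly compact.
   Context: No separation axioms are assumed (in particular compact does not include Hausdorff) and functions are not assumed continuous. For a subset $A$ of a topological space, $\mathrm{Int}(A)$ and $\mathrm{Cl}(A)$ denote interior and closure. $A$ is semi-open if $A \subseteq \mathrm{Cl}(\mathrm{Int}(A))$; semi-closed if its complement is semi-open (equivalently $\mathrm{Int}(\mathrm{Cl}(A)) \subseteq A$); semi-regular if it is both semi-open and semi-closed; regular open if $A = \mathrm{Int}(\mathrm{Cl}(A))$; regular closed if $A = \mathrm{Cl}(\mathrm{Int}(A))$. The semi-closure $\mathrm{sCl}(A)$ is the intersection of all semi-closed sets containing $A$. A function $f \colon (X,\tau)\to(Y,\sigma)$ is contra-semicontinuous (resp. $SR$-continuous, completely continuous, contra-continuous, $RC$-continuous, perfectly continuous) if the preimage of every open subset of $Y$ is semi-closed (resp. semi-regular, regular open, closed, regular closed, clopen) in $X$. A space $X$ is semi-compact (resp. $s$-closed, $S$-closed) if for every cover $\{V_i : i \in I\}$ of $X$ by semi-open sets there is a finite $F \subseteq I$ with $X = \bigcup_{i\in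 F} V_i$ (resp. $X = \bigcup_{i\in F} \mathrm{sCl}(V_i)$, $X = \bigcup_{i\in F} \mathrm{Cl}(V_i)$). $X$ is nearly compact if for every open cover $\{V_i : i\in I\}$ of $X$ there is a finite $F \subseteq I$ with $X = \bigcup_{i\in F} \mathrm{Int}(\mathrm{Cl}(V_i))$. $X$ is strongly $S$-closed (resp. mildly compact) if every cover of $X$ by closed (resp. clopen) sets has a finite subcover. *)

theory Defs
  imports "HOL-Analysis.Abstract_Topology"
begin

(* As with openin and closedin, the set predicates are relative to the topology and
   imply that the set is contained in topspace X. *)

definition semi_openin :: "'a topology \<Rightarrow> 'a set \<Rightarrow> bool" where
  "semi_openin X A \<longleftrightarrow> A \<subseteq> topspace X \<and> A \<subseteq> X closure_of (X interior_of A)"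

definition semi_closedin :: "'a topology \<Rightarrow> 'a set \<Rightarrow> bool" where
  "semi_closedin X A \<longleftrightarrow> A \<subseteq> topspace X \<and> semi_openin X (topspace X - A)"

definition semi_regularin :: "'a topology \<Rightarrow> 'a set \<Rightarrow> bool" where
  "semi_regularin X A \<longleftrightarrow> semi_openin X A \<and> semi_closedin X A"

definition regular_openin :: "'a topology \<Rightarrow> 'a set \<Rightarrow> bool" where
  "regular_openin X A \<longleftrightarrow> A = X interior_of (X closure_of A)"

definition regular_closedin :: "'a topology \<Rightarrow> 'a set \<Rightarrow> bool" where
  "regular_closedin X A \<longleftrightarrow> A = X closure_of (X interior_of A)"

definition clopenin :: "'a topology \<Rightarrow> 'a set \<Rightarrow> bool" where
  "clopenin X A \<longleftrightarrow> closedin X A \<and> openin X A"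

(* The intersected family is nonempty for A contained in topspace X, since topspace X
   itself is semi-closed. *)
definition semi_closure_of :: "'a topology \<Rightarrow> 'a set \<Rightarrow> 'a set" (infixr \<open>semi'_closure'_of\<close> 80) where
  "X semi_closure_of A = \<Inter>{C. semi_closedin X C \<and> A \<subseteq> C}"

(* The map predicates below follow the shape of continuous_map: f is a function from
   topspace X to topspace Y, and preimages are taken within topspace X. *)

definition contra_semicontinuous_map :: "'a topology \<Rightarrow> 'b topology \<Rightarrow> ('a \<Rightarrow> 'b) \<Rightarrow> bool" where
  "contra_semicontinuous_map X Y f \<longleftrightarrow>
     f \<in> topspace X \<rightarrow> topspace Y \<and>
     (\<forall>U. openin Y U \<longrightarrow> semi_closedin X {x \<in> topspace X. f x \<in> U})"

definition SR_continuous_map :: "'a topology \<Rightarrow> 'b topology \<Rightarrow> ('a \<Rightarrow> 'b) \<Rightarrow> bool" where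
  "SR_continuous_map X Y f \<longleftrightarrow>
     f \<in> topspace X \<rightarrow> topspace Y \<and>
     (\<forall>U. openin Y U \<longrightarrow> semi_regularin X {x \<in> topspace X. f x \<in> U})"

definition completely_continuous_map :: "'a topology \<Rightarrow> 'b topology \<Rightarrow> ('a \<Rightarrow> 'b) \<Rightarrow> bool" where
  "completely_continuous_map X Y f \<longleftrightarrow>
     f \<in> topspace X \<rightarrow> topspace Y \<and>
     (\<forall>U. openin Y U \<longrightarrow> regular_openin X {x \<in> topspace X. f x \<in> U})"

definition contra_continuous_map :: "'a topology \<Rightarrow> 'b topology \<Rightarrow> ('a \<Rightarrow> 'b) \<Rightarrow> bool" where
  "contra_continuous_map X Y f \<longleftrightarrow>
     f \<in> topspace X \<rightarrow> topspace Y \<and>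
     (\<forall>U. openin Y U \<longrightarrow> closedin X {x \<in> topspace X. f x \<in> U})"

definition RC_continuous_map :: "'a topology \<Rightarrow> 'b topology \<Rightarrow> ('a \<Rightarrow> 'b) \<Rightarrow> bool" where
  "RC_continuous_map X Y f \<longleftrightarrow>
     f \<in> topspace X \<rightarrow> topspace Y \<and>
     (\<forall>U. openin Y U \<longrightarrow> regular_closedin X {x \<in> topspace X. f x \<in> U})"

definition perfectly_continuous_map :: "'a topology \<Rightarrow> 'b topology \<Rightarrow> ('a \<Rightarrow> 'b) \<Rightarrow> bool" where
  "perfectly_continuous_map X Y f \<longleftrightarrow>
     f \<in> topspace X \<rightarrow> topspace Y \<and>
     (\<forall>U. openin Y U \<longrightarrow> clopenin X {x \<in> topspace X. f x \<in> U})"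

(* Covers are sets of sets rather than indexed families, as in the library's compactin. *)

definition semi_compact_space :: "'a topology \<Rightarrow> bool" where
  "semi_compact_space X \<longleftrightarrow>
     (\<forall>\<V>. (\<forall>V\<in>\<V>. semi_openin X V) \<and> \<Union>\<V> = topspace X \<longrightarrow>
        (\<exists>\<F>. finite \<F> \<and> \<F> \<subseteq> \<V> \<and> topspace X = \<Union>\<F>))"

(* The names s_closed_space and S_closed_space differ only in case, as is traditional:
   the former uses semi-closures, the latter closures. *)

definition s_closed_space :: "'a topology \<Rightarrow> bool" where
  "s_closed_space X \<longleftrightarrow>
     (\<forall>\<V>. (\<forall>V\<in>\<V>. semi_openin X V) \<and> \<Union>\<V> = topspace X \<longrightarrow>
        (\<exists>\<F>. finite \<F> \<and> \<F> \<subseteq> \<V> \<and> topspace X = (\<Union>V\<in>\<F>. X semi_closure_of V)))"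

definition S_closed_space :: "'a topology \<Rightarrow> bool" where
  "S_closed_space X \<longleftrightarrow>
     (\<forall>\<V>. (\<forall>V\<in>\<V>. semi_openin X V) \<and> \<Union>\<V> = topspace X \<longrightarrow>
        (\<exists>\<F>. finite \<F> \<and> \<F> \<subseteq> \<V> \<and> topspace X = (\<Union>V\<in>\<F>. X closure_of V)))"

definition nearly_compact_space :: "'a topology \<Rightarrow> bool" where
  "nearly_compact_space X \<longleftrightarrow>
     (\<forall>\<V>. (\<forall>V\<in>\<V>. openin X V) \<and> \<Union>\<V> = topspace X \<longrightarrow>
        (\<exists>\<F>. finite \<F> \<and> \<F> \<subseteq> \<V> \<and> topspace X = (\<Union>V\<in>\<F>. X interior_of (X closure_of V))))"

definition strongly_S_closed_space :: "'a topology \<Rightarrow> bool" where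
  "strongly_S_closed_space X \<longleftrightarrow>
     (\<forall>\<V>. (\<forall>V\<in>\<V>. closedin X V) \<and> \<Union>\<V> = topspace X \<longrightarrow>
        (\<exists>\<F>. finite \<F> \<and> \<F> \<subseteq> \<V> \<and> topspace X = \<Union>\<F>))"

definition mildly_compact_space :: "'a topology \<Rightarrow> bool" where
  "mildly_compact_space X \<longleftrightarrow>
     (\<forall>\<V>. (\<forall>V\<in>\<V>. clopenin X V) \<and> \<Union>\<V> = topspace X \<longrightarrow>
        (\<exists>\<F>. finite \<F> \<and> \<F> \<subseteq> \<V> \<and> topspace X = \<Union>\<F>))"

end

theory Submission
  imports Defs
begin

text \<open>
  In each case the preimages of closed sets under \<open>f\<close> form a class of sets to whose covers the
  covering property of \<open>X\<close> applies, and the enlargement operator of that covering property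
  (identity, semi-closure, closure or interior of closure) fixes every set in the class. Hence the
  preimage of a closed cover of \<open>Y\<close> has a finite subcover, and its image under the surjection \<open>f\<close>
  is a finite subcover of the original one.
\<close>

lemma strongly_S_closed_space_surj_image:
  fixes P :: "'a set \<Rightarrow> bool" and c :: "'a set \<Rightarrow> 'a set"
  assumes surj: "f ` topspace X = topspace Y"
    and preim: "\<And>U. openin Y U \<Longrightarrow> P (topspace X - {x \<in> topspace X. f x \<in> U})"
    and fix_c: "\<And>V. P V \<Longrightarrow> c V = V"
    and cover: "\<And>\<V>. \<lbrakk>\<forall>V\<in>\<V>. P V; \<Union>\<V> = topspace X\<rbrakk> \<Longrightarrow>
                  \<exists>\<F>. finite \<F> \<and> \<F> \<subseteq> \<V> \<and> topspace X = (\<Union>V\<in>\<F>. c V)"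
  shows "strongly_S_closed_space Y"
  unfolding strongly_S_closed_space_def
proof (intro allI impI, elim conjE)
  fix \<V> assume closed: "\<forall>V\<in>\<V>. closedin Y V" and Un: "\<Union>\<V> = topspace Y"
  define g where "g V = {x \<in> topspace X. f x \<in> V}" for V
  have P_g: "P (g V)" if "V \<in> \<V>" for V
  proof -
    \<comment> \<open>The continuity notions speak of open sets, so \<open>g V\<close> is written as
      the complement of the preimage of the open set \<open>topspace Y - V\<close>. This needs that
      \<open>f\<close> maps into \<open>topspace Y\<close>.\<close>
    have "g V = topspace X - {x \<in> topspace X. f x \<in> topspace Y - V}"
      using surj unfolding g_def by auto
    moreover have "openin Y (topspace Y - V)"
      using closed that by blast
    ultimately show ?thesis
      by (simp only: preim)
  qed
  have "\<Union>(g ` \<V>) = topspace X"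
    using surj Un unfolding g_def by blast
  then obtain \<G> where \<G>: "finite \<G>" "\<G> \<subseteq> g ` \<V>" "topspace X = (\<Union>V\<in>\<G>. c V)"
    using cover[of "g ` \<V>"] P_g by blast
  \<comment> \<open>Choosing one member of \<open>\<V>\<close> for each of the finitely many
    preimages in \<open>\<G>\<close> returns to a subfamily of the given cover.\<close>
  obtain \<F> where \<F>: "finite \<F>" "\<F> \<subseteq> \<V>" and "\<G> = g ` \<F>"
    using finite_subset_image[OF \<G>(1,2)] by blast
  then have "topspace X = (\<Union>V\<in>\<F>. c (g V))"
    using \<G>(3) by simp
  moreover have "c (g V) = g V" if "V \<in> \<F>" for V
    using P_g \<F>(2) fix_c that by blast
  ultimately have "topspace X = (\<Union>V\<in>\<F>. g V)"
    by simp
  then have "topspace X \<subseteq> (\<Union>V\<in>\<F>. g V)"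
    by simp
  \<comment> \<open>By surjectivity each point of \<open>Y\<close> is some \<open>f x\<close>, and
    \<open>x\<close> in \<open>g V\<close> means that \<open>f x\<close> lies in
    \<open>V\<close>.\<close>
  then have "topspace Y \<subseteq> \<Union>\<F>"
    unfolding g_def surj[symmetric] by blast
  then have "topspace Y = \<Union>\<F>"
    using \<F>(2) Un by blast
  then show "\<exists>\<F>. finite \<F> \<and> \<F> \<subseteq> \<V> \<and> topspace Y = \<Union>\<F>"
    using \<F> by blast
qed

lemma semi_openin_Compl: "semi_closedin X A \<Longrightarrow> semi_openin X (topspace X - A)"
  by (simp add: semi_closedin_def)

lemma semi_closedin_Compl: "semi_openin X A \<Longrightarrow> semi_closedin X (topspace X - A)"
  by (simp add: semi_closedin_def semi_openin_def double_diff)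

text \<open>\<open>A\<close> is itself a member of the intersected family, and every other member
  contains it.\<close>

lemma semi_closure_of_eq: "semi_closedin X A \<Longrightarrow> X semi_closure_of A = A"
  unfolding semi_closure_of_def by blast

text \<open>Complementation exchanges interior and closure, so it carries fixed points of
  interior-of-closure to fixed points of closure-of-interior.\<close>

lemma regular_closedin_Compl:
  assumes "regular_openin X A"
  shows "regular_closedin X (topspace X - A)"
proof -
  have "X closure_of (X interior_of (topspace X - A)) = topspace X - X interior_of (X closure_of A)"
    by (simp add: interior_of_complement closure_of_complement)
  then show ?thesis
    using assms unfolding regular_openin_def regular_closedin_def by argo
qed

lemma regular_openin_Compl:
  assumes "regular_closedin X A"
  shows "regular_openin X (topspace X - A)"
proof -
  have "X interior_of (X closure_of (topspace X - A)) = topspace X - X closure_of (X interior_of A)"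
    by (simp add: interior_of_complement closure_of_complement)
  then show ?thesis
    using assms unfolding regular_openin_def regular_closedin_def by argo
qed

lemma regular_closedin_imp_closedin: "regular_closedin X A \<Longrightarrow> closedin X A"
  unfolding regular_closedin_def by (erule ssubst) (rule closedin_closure_of)

lemma regular_closedin_imp_semi_openin: "regular_closedin X A \<Longrightarrow> semi_openin X A"
  using regular_closedin_imp_closedin[of X A] closedin_subset[of X A]
  unfolding regular_closedin_def semi_openin_def by blast

lemma regular_openin_imp_openin: "regular_openin X A \<Longrightarrow> openin X A"
  unfolding regular_openin_def by (erule ssubst) (rule openin_interior_of)

theorem theorem4p2:
  fixes X :: "'a topology" and Y :: "'b topology" and f :: "'a \<Rightarrow> 'b"
  assumes "f ` topspace X = topspace Y"
    and "(contra_semicontinuous_map X Y f \<and> semi_compact_space X) \<or>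
         (SR_continuous_map X Y f \<and> s_closed_space X) \<or>
         (completely_continuous_map X Y f \<and> S_closed_space X) \<or>
         (contra_continuous_map X Y f \<and> compact_space X) \<or>
         (RC_continuous_map X Y f \<and> nearly_compact_space X) \<or>
         (perfectly_continuous_map X Y f \<and> mildly_compact_space X)"
  shows "strongly_S_closed_space Y"
  using assms(2)
proof (elim disjE conjE)
  assume f: "contra_semicontinuous_map X Y f" and X: "semi_compact_space X"
  show ?thesis
  proof (rule strongly_S_closed_space_surj_image[OF assms(1), of "semi_openin X" "\<lambda>V. V"])
    show "semi_openin X (topspace X - {x \<in> topspace X. f x \<in> U})" if "openin Y U" for U
      using f that unfolding contra_semicontinuous_map_def by (blast intro: semi_openin_Compl)
  qed (use X in \<open>simp_all add: semi_compact_space_def\<close>)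
next
  assume f: "SR_continuous_map X Y f" and X: "s_closed_space X"
  \<comment> \<open>Semi-regularity is stable under complement. Its semi-open half lets the covering
    property apply; its semi-closed half makes the semi-closures trivial.\<close>
  show ?thesis
  proof (rule strongly_S_closed_space_surj_image
      [OF assms(1), of "semi_regularin X" "\<lambda>V. X semi_closure_of V"])
    show "semi_regularin X (topspace X - {x \<in> topspace X. f x \<in> U})" if "openin Y U" for U
      using f that unfolding SR_continuous_map_def semi_regularin_def
      by (blast intro: semi_openin_Compl semi_closedin_Compl)
  qed (use X in \<open>simp_all add: s_closed_space_def semi_regularin_def semi_closure_of_eq\<close>)
next
  assume f: "completely_continuous_map X Y f" and X: "S_closed_space X"
  \<comment> \<open>Regular closed sets are semi-open, so they form admissible covers, and closed,
    so taking closures changes nothing.\<close>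
  show ?thesis
  proof (rule strongly_S_closed_space_surj_image
      [OF assms(1), of "regular_closedin X" "\<lambda>V. X closure_of V"])
    show "regular_closedin X (topspace X - {x \<in> topspace X. f x \<in> U})" if "openin Y U" for U
      using f that unfolding completely_continuous_map_def by (blast intro: regular_closedin_Compl)
  qed (use X in \<open>simp_all add: S_closed_space_def closure_of_closedin
        regular_closedin_imp_closedin regular_closedin_imp_semi_openin\<close>)
next
  assume f: "contra_continuous_map X Y f" and X: "compact_space X"
  show ?thesis
  proof (rule strongly_S_closed_space_surj_image[OF assms(1), of "openin X" "\<lambda>V. V"])
    show "openin X (topspace X - {x \<in> topspace X. f x \<in> U})" if "openin Y U" for U
      using f that unfolding contra_continuous_map_def by blast
    show "\<exists>\<F>. finite \<F> \<and> \<F> \<subseteq> \<V> \<and> topspace X = (\<Union>V\<in>\<F>. V)"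
      if \<V>: "\<forall>V\<in>\<V>. openin X V" "\<Union>\<V> = topspace X" for \<V>
    proof -
      obtain \<F> where "finite \<F>" "\<F> \<subseteq> \<V>" "topspace X \<subseteq> \<Union>\<F>"
        using X \<V> unfolding compact_space_alt by (metis order_refl)
      \<comment> \<open>Compactness yields only an inclusion; the reverse one comes from
        \<open>\<F> \<subseteq> \<V>\<close>.\<close>
      then show ?thesis
        using \<V>(2) by (intro exI[of _ \<F>]) auto
    qed
  qed simp
next
  assume f: "RC_continuous_map X Y f" and X: "nearly_compact_space X"
  \<comment> \<open>Regular open sets are open, and by definition they are the fixed points of
    interior-of-closure.\<close>
  show ?thesis
  proof (rule strongly_S_closed_space_surj_image
      [OF assms(1), of "regular_openin X" "\<lambda>V. X interior_of (X closure_of V)"])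
    show "regular_openin X (topspace X - {x \<in> topspace X. f x \<in> U})" if "openin Y U" for U
      using f that unfolding RC_continuous_map_def by (blast intro: regular_openin_Compl)
    show "X interior_of (X closure_of V) = V" if "regular_openin X V" for V
      using that unfolding regular_openin_def by (rule sym)
  qed (use X in \<open>simp add: nearly_compact_space_def regular_openin_imp_openin\<close>)
next
  assume f: "perfectly_continuous_map X Y f" and X: "mildly_compact_space X"
  show ?thesis
  proof (rule strongly_S_closed_space_surj_image[OF assms(1), of "clopenin X" "\<lambda>V. V"])
    show "clopenin X (topspace X - {x \<in> topspace X. f x \<in> U})" if "openin Y U" for U
      using f that unfolding perfectly_continuous_map_def clopenin_def by blast
  qed (use X in \<open>simp_all add: mildly_compact_space_def\<close>)
qed

end
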